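(* Given any fixed integer $r\ge 2$, let $\psi_r$ be the threshold for $r$-orientability. Then for any $\epsilon>0$ there exists $\delta>0$ such that if $p=p(n)\ge \frac{\psi_r+\epsilon}{n}$, then with probability tending to $1$ as $n\to\infty$ the random graph $G\sim G(n,p)$ has the property that every $r$-coloring of $E(G)$ produces a cycle of length at least $\delta n$ in one of the colors (i.e. a monochromatic cycle of length at least $\delta n$).
   Context: $G(n,p)$ is the binomial random graph on $n$ labelled vertices with edge probability $p$. "Whp" means with probability tending to $1$ as $n\to\infty$. A graph is called $r$-orientable if its edges can be directed so that all out-degrees in the resulting digraph are at most $r$. For each integer $r\ge 2$, the threshold for $r$-orientability $\psi_r$ is the constant (known to exist, by results of Cain, Sanders and Wormald, and of Fernholz and Ramachandran) such that for every $\epsilon>0$: if $p<\frac{\psi_r-\epsilon}{n}$, then $G\sim G(n,p)$ is $r$-orientable whp; and if $p>\frac{\psi_r+\epsilon}{n}$, then whp $G\sim G(n,p)$ contains a subgraph with average degree at least $2r+\delta'$ for some $\delta'=\delta'(\epsilon)>0$ (and is thus not $r$-orientable). This threshold coincides with the one for the $(r+1)$-core of $G(n,p)$ to have average degree above $2r$. *)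

theory Defs
  imports "HOL-Probability.Probability" "HOL-Probability.Product_PMF"
begin

text \<open>A simple graph is given by a vertex set and a set of edges, each edge being a set of
  two vertices.\<close>

definition all_edges :: "'a set \<Rightarrow> 'a set set" where
  "all_edges V = {e. e \<subseteq> V \<and> card e = 2}"

definition is_subgraph :: "'a set \<Rightarrow> 'a set set \<Rightarrow> 'a set \<Rightarrow> 'a set set \<Rightarrow> bool" where
  "is_subgraph V' E' V E \<longleftrightarrow> V' \<subseteq> V \<and> E' \<subseteq> E \<and> E' \<subseteq> all_edges V'"

definition degree :: "'a set set \<Rightarrow> 'a \<Rightarrow> nat" where
  "degree E v = card {e \<in> E. v \<in> e}"

definition average_degree :: "'a set \<Rightarrow> 'a set set \<Rightarrow> real" where
  "average_degree V E = (\<Sum>v\<in>V. real (degree E v)) / real (card V)"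

text \<open>The cycle through the vertices \<open>vs\<close> in cyclic order; it has \<open>length vs\<close> edges.\<close>

definition is_cycle :: "'a set set \<Rightarrow> 'a list \<Rightarrow> bool" where
  "is_cycle E vs \<longleftrightarrow> length vs \<ge> 3 \<and> distinct vs \<and>
     (\<forall>i < length vs. {vs ! i, vs ! (Suc i mod length vs)} \<in> E)"

text \<open>The bijection says that every edge receives exactly one of its two directions.\<close>

definition is_orientation :: "'a set set \<Rightarrow> ('a \<times> 'a) set \<Rightarrow> bool" where
  "is_orientation E D \<longleftrightarrow> bij_betw (\<lambda>(u, v). {u, v}) D E"

definition orientable :: "nat \<Rightarrow> 'a set \<Rightarrow> 'a set set \<Rightarrow> bool" where
  "orientable r V E \<longleftrightarrow>
     (\<exists>D. is_orientation E D \<and> (\<forall>u\<in>V. card {v. (u, v) \<in> D} \<le> r))"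

definition gnp :: "nat \<Rightarrow> real \<Rightarrow> nat set set pmf" where
  "gnp n p = map_pmf (\<lambda>f. {e \<in> all_edges {..<n}. f e})
     (Pi_pmf (all_edges {..<n}) False (\<lambda>_. bernoulli_pmf p))"

definition whp :: "(nat \<Rightarrow> real) \<Rightarrow> (nat \<Rightarrow> nat set set \<Rightarrow> bool) \<Rightarrow> bool" where
  "whp p P \<longleftrightarrow> (\<lambda>n. measure_pmf.prob (gnp n (p n)) {E. P n E}) \<longlonglongrightarrow> 1"

definition edge_probability :: "(nat \<Rightarrow> real) \<Rightarrow> bool" where
  "edge_probability p \<longleftrightarrow> (\<forall>n. 0 \<le> p n \<and> p n \<le> 1)"

text \<open>Bounds on \<open>p n\<close> are imposed for all large \<open>n\<close> only: the lower bounds exceed 1 for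
  small \<open>n\<close>, and division by \<open>n = 0\<close> is degenerate. Above the threshold the graph
  is in particular not \<open>r\<close>-orientable, since a graph with an orientation of out-degrees
  at most \<open>r\<close> has no subgraph of average degree above \<open>2 r\<close>.\<close>

definition orientability_threshold :: "nat \<Rightarrow> real \<Rightarrow> bool" where
  "orientability_threshold r \<psi> \<longleftrightarrow>
     (\<forall>\<epsilon>>0.
        (\<forall>p. edge_probability p \<longrightarrow>
             (\<forall>\<^sub>F n in sequentially. p n < (\<psi> - \<epsilon>) / real n) \<longrightarrow>
             whp p (\<lambda>n E. orientable r {..<n} E)) \<and>
        (\<exists>\<delta>'>0. \<forall>p. edge_probability p \<longrightarrow>
             (\<forall>\<^sub>F n in sequentially. p n > (\<psi> + \<epsilon>) / real n) \<longrightarrow>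
             whp p (\<lambda>n E. \<exists>V' E'. is_subgraph V' E' {..<n} E \<and> V' \<noteq> {} \<and>
                                  average_degree V' E' \<ge> 2 * real r + \<delta>')))"

definition edge_coloring :: "nat \<Rightarrow> 'a set set \<Rightarrow> ('a set \<Rightarrow> nat) \<Rightarrow> bool" where
  "edge_coloring r E c \<longleftrightarrow> (\<forall>e\<in>E. c e < r)"

end

theory Submission imports Defs begin

text \<open>
  Above the threshold, \<open>G\<close> whp contains a subgraph \<open>(V', E')\<close> of average degree at least
  \<open>2 r + \<delta>'\<close>. The most frequent of the \<open>r\<close> colours then has at least \<open>(1 + 2 \<eta>) |V'|\<close> edges in it,
  where \<open>\<eta> = \<delta>' / (4 r)\<close>, and the claim is that a graph \<open>H\<close> with so many edges inside a sparse
  random graph must contain a cycle of linear length.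

  Suppose that all cycles of \<open>H\<close> have fewer than \<open>L\<close> vertices. A depth-first exploration of \<open>H\<close>
  then only sees edges that join vertices at distance less than \<open>L\<close> along the current search path,
  so some \<open>L\<close> consecutive vertices of this path cut off a part with more than \<open>s\<close> vertices in which
  only pieces of size at most \<open>s\<close> remain. Repeating this on the rest of the graph gives a separator
  \<open>Y\<close> with \<open>s |Y| \<le> L |V'|\<close> such that every connected part of \<open>H - Y\<close> has at most \<open>s\<close> vertices
  (\<open>small_separator\<close>). Two properties of \<open>G(n, C/n)\<close> contradict this for \<open>s = \<alpha> n\<close> and \<open>L = \<delta> n\<close>
  with \<open>\<delta>\<close> much smaller than \<open>\<alpha>\<close>:

  \<^item> Whp every set \<open>S\<close> of at most \<open>\<alpha> n\<close> vertices spans at most \<open>(1 + \<eta>) |S|\<close> edges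
    (\<open>whp_locally_sparse\<close>). Hence the small parts of \<open>H - Y\<close> contain at most \<open>(1 + \<eta>) |V'|\<close> edges
    altogether. The same property forces \<open>|V'| > \<alpha> n\<close>, because \<open>V'\<close> spans too many edges.

  \<^item> Whp a set of at most \<open>\<gamma> n\<close> vertices, such as \<open>Y\<close>, meets at most \<open>\<eta> \<alpha> n / 2\<close> edges
    (\<open>whp_few_incident_edges\<close>), and this is less than \<open>\<eta> |V'|\<close>.

  So \<open>H\<close> would have fewer than \<open>(1 + 2 \<eta>) |V'|\<close> edges. Both properties are first moment estimates that
  need \<open>p \<le> C / n\<close>. Larger \<open>p\<close> reduce to \<open>p = (\<psi> + \<epsilon>) / n\<close>, since the conclusion is inherited by
  supergraphs and \<open>G(n, p)\<close> can be coupled monotonically in \<open>p\<close> (\<open>prob_gnp_mono\<close>).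
\<close>

section \<open>Connected vertex sets and paths\<close>

text \<open>Connectivity is expressed by cuts rather than by paths: this form passes to \<open>insert b C\<close>
  (\<open>connected_in_insert\<close>) and directly yields the edges that leave a part of \<open>C\<close>, which is how it is
  used below. Paths are recovered in \<open>connected_in_path\<close>.\<close>

definition connected_in :: "'a set set \<Rightarrow> 'a set \<Rightarrow> bool" where
  "connected_in E C \<longleftrightarrow>
     (\<forall>A\<subseteq>C. A \<noteq> {} \<longrightarrow> A \<noteq> C \<longrightarrow> (\<exists>a\<in>A. \<exists>b\<in>C - A. {a, b} \<in> E))"

lemma connected_in_crossing_edge:
  assumes "connected_in E C" "A \<subseteq> C" "A \<noteq> {}" "A \<noteq> C"
  obtains a b where "a \<in> A" "b \<in> C - A" "{a, b} \<in> E"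
  using assms unfolding connected_in_def by blast

lemma connected_in_singleton: "connected_in E {x}"
  unfolding connected_in_def by blast

lemma connected_in_insert:
  assumes C: "connected_in E C" and "c \<in> C" "{c, b} \<in> E"
  shows "connected_in E (insert b C)"
proof (cases "b \<in> C")
  case True
  then show ?thesis using C by (simp add: insert_absorb)
next
  case False
  show ?thesis
    unfolding connected_in_def
  proof (intro allI impI)
    fix A assume A: "A \<subseteq> insert b C" "A \<noteq> {}" "A \<noteq> insert b C"
    consider "A \<inter> C = {}" | "A \<inter> C = C" | "A \<inter> C \<noteq> {}" "A \<inter> C \<noteq> C" by blast
    then show "\<exists>x\<in>A. \<exists>y\<in>insert b C - A. {x, y} \<in> E"
    proof cases
      case 1
      then have "A = {b}" using A by blast
      then show ?thesis using assms(2,3) False by (auto simp: insert_commute)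
    next
      case 2
      then have "A = C" using A by blast
      then show ?thesis using assms(2,3) False by auto
    next
      case 3
      then obtain x y where "x \<in> A \<inter> C" "y \<in> C - A \<inter> C" "{x, y} \<in> E"
        using connected_in_crossing_edge[OF C, of "A \<inter> C"] by blast
      then show ?thesis by blast
    qed
  qed
qed

text \<open>A connected subset of \<open>Z\<close> that is maximal under inclusion has no edge to the rest of \<open>Z\<close>, as the
  other endpoint of such an edge could be added.\<close>

lemma exists_component_containing:
  assumes "finite Z" "C\<^sub>0 \<subseteq> Z" "connected_in E C\<^sub>0"
  obtains C where "C\<^sub>0 \<subseteq> C" "C \<subseteq> Z" "connected_in E C"
    "\<And>c b. c \<in> C \<Longrightarrow> b \<in> Z - C \<Longrightarrow> {c, b} \<notin> E"
proof -
  let ?\<C> = "{C. C \<subseteq> Z \<and> connected_in E C}"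
  have "finite ?\<C>" using assms(1) by (auto intro: finite_subset[of _ "Pow Z"])
  moreover have "C\<^sub>0 \<in> ?\<C>" using assms(2,3) by simp
  ultimately obtain C where C: "C \<in> ?\<C>" "C\<^sub>0 \<subseteq> C" "\<And>D. D \<in> ?\<C> \<Longrightarrow> C \<subseteq> D \<Longrightarrow> C = D"
    using finite_has_maximal2[of ?\<C> C\<^sub>0] by metis
  show thesis
  proof
    show "{c, b} \<notin> E" if "c \<in> C" "b \<in> Z - C" for c b
    proof
      assume "{c, b} \<in> E"
      then have "insert b C \<in> ?\<C>" using C(1) that connected_in_insert[of E C c b] by auto
      then show False using C(3)[of "insert b C"] that by blast
    qed
  qed (use C in auto)
qed

text \<open>The vertices of \<open>C\<close> reachable from \<open>a\<close> by a path form a set without edges to the rest of \<open>C\<close>,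
  so by the definition of connectivity they are all of \<open>C\<close>.\<close>

lemma connected_in_path:
  assumes C: "connected_in E C" and a: "a \<in> C" and b: "b \<in> C"
  obtains xs where "xs \<noteq> []" "hd xs = a" "last xs = b" "set xs \<subseteq> C" "distinct xs"
    "successively (\<lambda>x y. {x, y} \<in> E) xs"
proof -
  define path where "path x xs \<longleftrightarrow> xs \<noteq> [] \<and> hd xs = a \<and> last xs = x \<and> set xs \<subseteq> C \<and>
    distinct xs \<and> successively (\<lambda>x y. {x, y} \<in> E) xs" for x xs
  define A where "A = {x \<in> C. \<exists>xs. path x xs}"
  have "path a [a]" using a by (simp add: path_def)
  then have "a \<in> A" using a by (auto simp: A_def)
  have "A = C"
  proof (rule ccontr)
    assume "A \<noteq> C"
    moreover have "A \<subseteq> C" by (auto simp: A_def)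
    ultimately obtain x y where xy: "x \<in> A" "y \<in> C - A" "{x, y} \<in> E"
      using connected_in_crossing_edge[OF C] \<open>a \<in> A\<close> by blast
    obtain xs where xs: "path x xs" using xy(1) by (auto simp: A_def)
    show False
    proof (cases "y \<in> set xs")
      case True
      then obtain us vs where us: "xs = us @ y # vs" by (meson split_list)
      \<comment> \<open>The initial segment of the path up to \<open>y\<close> would already reach \<open>y\<close>.\<close>
      have "successively (\<lambda>x y. {x, y} \<in> E) ((us @ [y]) @ vs)"
        using xs by (simp add: path_def us)
      then have "successively (\<lambda>x y. {x, y} \<in> E) (us @ [y])"
        unfolding successively_append_iff[of _ "us @ [y]"] by blast
      then have "path y (us @ [y])"
        using xs unfolding path_def us by (auto simp: hd_append)
      then show False using xy(2) by (auto simp: A_def)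
    next
      case False
      then have "path y (xs @ [y])"
        using xs xy unfolding path_def by (auto simp: successively_append_iff)
      then show False using xy(2) by (auto simp: A_def)
    qed
  qed
  then obtain xs where "path b xs" using b by (auto simp: A_def)
  then show thesis using that by (auto simp: path_def)
qed

lemma is_cycle_mono: "is_cycle E vs \<Longrightarrow> E \<subseteq> E' \<Longrightarrow> is_cycle E' vs"
  by (auto simp: is_cycle_def)

lemma is_cycleI:
  assumes "length vs \<ge> 3" "distinct vs" "successively (\<lambda>x y. {x, y} \<in> E) vs"
    and "{last vs, hd vs} \<in> E"
  shows "is_cycle E vs"
proof -
  have "{vs ! i, vs ! (Suc i mod length vs)} \<in> E" if "i < length vs" for i
  proof (cases "Suc i = length vs")
    case True
    moreover have "vs \<noteq> []" using assms(1) by auto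
    ultimately have "vs ! i = last vs" "vs ! 0 = hd vs"
      by (auto simp: last_conv_nth hd_conv_nth simp flip: \<open>Suc i = length vs\<close>)
    then show ?thesis using assms(4) True by simp
  next
    case False
    then have "Suc i < length vs" using that by simp
    moreover have "vs = take i vs @ vs ! i # vs ! Suc i # drop (Suc (Suc i)) vs"
      using calculation by (metis Cons_nth_drop_Suc Suc_lessD id_take_nth_drop)
    then have "successively (\<lambda>x y. {x, y} \<in> E) (take i vs @ vs ! i # vs ! Suc i # drop (Suc (Suc i)) vs)"
      using assms(3) by metis
    then have "{vs ! i, vs ! Suc i} \<in> E" by (simp add: successively_append_iff)
    ultimately show ?thesis by simp
  qed
  then show ?thesis using assms by (auto simp: is_cycle_def)
qed

section \<open>Separators of graphs without long cycles\<close>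

definition neighbourhood :: "'a set set \<Rightarrow> 'a set \<Rightarrow> 'a set \<Rightarrow> 'a set" where
  "neighbourhood E V U = {x \<in> V - U. \<exists>u\<in>U. {u, x} \<in> E}"

text \<open>This is where short cycles enter. If a neighbour \<open>x\<close> of \<open>U\<close> lies on the path \<open>P\<close>, then the part of
  \<open>P\<close> from \<open>x\<close> to its last vertex closes up through the connected set \<open>U\<close> to a cycle. So \<open>x\<close>
  is among the last \<open>L - 1\<close> vertices of \<open>P\<close>.\<close>

lemma neighbourhood_on_path_is_short:
  assumes P: "distinct P" "successively (\<lambda>x y. {x, y} \<in> E) P" "set P \<inter> U = {}"
    and U: "connected_in E U"
    and last: "P \<noteq> [] \<Longrightarrow> \<exists>q\<in>U. {last P, q} \<in> E"
    and N: "neighbourhood E V U \<subseteq> set P"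
    and L: "L \<ge> 2" and cyc: "\<And>vs. is_cycle E vs \<Longrightarrow> length vs < L"
  shows "card (neighbourhood E V U) < L"
proof -
  have "neighbourhood E V U \<subseteq> set (drop (Suc (length P) - L) P)"
  proof
    fix x assume x: "x \<in> neighbourhood E V U"
    then obtain u where u: "u \<in> U" "{u, x} \<in> E" by (auto simp: neighbourhood_def)
    obtain i where i: "i < length P" "P ! i = x" using x N by (metis in_set_conv_nth subsetD)
    then obtain q where q: "q \<in> U" "{last P, q} \<in> E" using last by fastforce
    obtain Q where Q: "Q \<noteq> []" "hd Q = q" "last Q = u" "set Q \<subseteq> U" "distinct Q"
      "successively (\<lambda>x y. {x, y} \<in> E) Q"
      using connected_in_path[OF U q(1) u(1)] by metis
    let ?R = "drop i P"
    have split: "P = take i P @ ?R" by simp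
    have R: "distinct ?R" "successively (\<lambda>x y. {x, y} \<in> E) ?R" "?R \<noteq> []" "set ?R \<inter> U = {}"
      "hd ?R = x" "last ?R = last P"
      using P i split set_drop_subset[of i P]
      by (auto simp: hd_drop_conv_nth) (metis split successively_append_iff)
    have "length ?R < L"
    proof (rule ccontr)
      assume "\<not> length ?R < L"
      then have len: "length (?R @ Q) \<ge> Suc L" using Q(1) by (cases Q) auto
      then have "is_cycle E (?R @ Q)"
        using R Q u q L by (intro is_cycleI) (auto simp: successively_append_iff insert_commute)
      then show False using cyc len by fastforce
    qed
    then have "Suc (length P) - L \<le> i" by simp
    then have "drop (Suc (length P) - L) P ! (i - (Suc (length P) - L)) = x"
      using i by simp
    moreover have "i - (Suc (length P) - L) < length (drop (Suc (length P) - L) P)"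
      using i(1) \<open>Suc (length P) - L \<le> i\<close> by simp
    ultimately show "x \<in> set (drop (Suc (length P) - L) P)" by (metis nth_mem)
  qed
  then have "card (neighbourhood E V U) \<le> length (drop (Suc (length P) - L) P)"
    by (meson List.finite_set card_length card_mono le_trans)
  also have "\<dots> < L" using L by simp
  finally show ?thesis .
qed

definition all_connected_parts_small :: "'a set set \<Rightarrow> nat \<Rightarrow> 'a set \<Rightarrow> bool" where
  "all_connected_parts_small E s Z \<longleftrightarrow> (\<forall>C\<subseteq>Z. connected_in E C \<longrightarrow> card C \<le> s)"

text \<open>One branch of a depth-first search, with \<open>P\<close> the current search path and \<open>U\<close> an unexplored connected
  set hanging off its end. As long as deleting the next vertex \<open>u\<close> leaves a connected part of \<open>U\<close>
  with more than \<open>s\<close> vertices, the search moves to \<open>u\<close> and into the component of such a part. When it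
  stops, \<open>u\<close> and the fewer than \<open>L\<close> neighbours of \<open>U\<close> on the path separate \<open>U\<close> from the rest and
  break it into small parts.\<close>

lemma detach_large_set_along_path:
  assumes "finite V" and L: "L \<ge> 2" and cyc: "\<And>vs. is_cycle E vs \<Longrightarrow> length vs < L"
    and "distinct P" "successively (\<lambda>x y. {x, y} \<in> E) P" "set P \<inter> U = {}"
    and "U \<subseteq> V" "connected_in E U" "card U > s"
    and "P \<noteq> [] \<Longrightarrow> \<exists>q\<in>U. {last P, q} \<in> E"
    and "neighbourhood E V U \<subseteq> set P"
  shows "\<exists>U X. U \<subseteq> V \<and> X \<subseteq> V \<and> card U > s \<and> card X \<le> L \<and> neighbourhood E V U \<subseteq> X \<and>
    all_connected_parts_small E s (U - X)"
  using assms(4-)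
proof (induction "card U" arbitrary: U P rule: less_induct)
  case less
  have finU: "finite U" using less.prems(4) \<open>finite V\<close> finite_subset by blast
  obtain u where u: "u \<in> U" "P \<noteq> [] \<Longrightarrow> {last P, u} \<in> E"
    using less.prems(6,7) by (metis card.empty ex_in_conv not_less0)
  show ?case
  proof (cases "all_connected_parts_small E s (U - {u})")
    case True
    let ?X = "insert u (neighbourhood E V U)"
    have "card (neighbourhood E V U) < L"
      by (rule neighbourhood_on_path_is_short[of P]) (use less.prems L cyc in auto)
    moreover have "finite (neighbourhood E V U)"
      using \<open>finite V\<close> by (simp add: neighbourhood_def)
    ultimately have "card ?X \<le> L" by (simp add: card_insert_if)
    moreover have "all_connected_parts_small E s (U - ?X)"
      using True by (auto simp: all_connected_parts_small_def)
    moreover have "?X \<subseteq> V" using u less.prems(4) by (auto simp: neighbourhood_def)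
    ultimately show ?thesis using less.prems(4,6) by blast
  next
    case False
    then obtain C\<^sub>0 where C0: "C\<^sub>0 \<subseteq> U - {u}" "connected_in E C\<^sub>0" "card C\<^sub>0 > s"
      by (auto simp: all_connected_parts_small_def not_le)
    obtain C where C: "C\<^sub>0 \<subseteq> C" "C \<subseteq> U - {u}" "connected_in E C"
      "\<And>c b. c \<in> C \<Longrightarrow> b \<in> U - {u} - C \<Longrightarrow> {c, b} \<notin> E"
      using exists_component_containing[of "U - {u}" C\<^sub>0 E] C0 finU by blast
    have finC: "finite C" using C(2) finU finite_subset by blast
    have big: "card C > s" using less_le_trans[OF C0(3) card_mono[OF finC C(1)]] .
    then have "C \<noteq> {}" by auto
    moreover have "C \<subseteq> U" "C \<noteq> U" using C(2) u(1) by auto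
    ultimately obtain a b where ab: "a \<in> C" "b \<in> U - C" "{a, b} \<in> E"
      using connected_in_crossing_edge[OF less.prems(5)] by blast
    then have "b = u" using C(4) by blast
    then have adj: "\<exists>q\<in>C. {last (P @ [u]), q} \<in> E" using ab by (auto simp: insert_commute)
    have "neighbourhood E V C \<subseteq> set (P @ [u])"
    proof
      fix x assume x: "x \<in> neighbourhood E V C"
      show "x \<in> set (P @ [u])"
      proof (cases "x \<in> U")
        case True
        then show ?thesis using x C(4) by (auto simp: neighbourhood_def)
      next
        case False
        then have "x \<in> neighbourhood E V U" using x \<open>C \<subseteq> U\<close> by (auto simp: neighbourhood_def)
        then show ?thesis using less.prems(8) by auto
      qed
    qed
    moreover have "card C < card U" using \<open>C \<subseteq> U\<close> \<open>C \<noteq> U\<close> finU by (simp add: psubset_card_mono psubset_eq)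
    moreover have "distinct (P @ [u])" "successively (\<lambda>x y. {x, y} \<in> E) (P @ [u])"
      "set (P @ [u]) \<inter> C = {}"
      using less.prems(1-3) u C(2) by (auto simp: successively_append_iff)
    moreover have "C \<subseteq> V" using \<open>C \<subseteq> U\<close> less.prems(4) by (rule subset_trans)
    ultimately show ?thesis
      using big C(3) adj by (intro less.hyps[of C "P @ [u]"]) assumption+
  qed
qed

text \<open>Each detached set \<open>U\<close> has more than \<open>s\<close> vertices and costs at most \<open>L\<close> separating vertices, so
  \<open>s |X| \<le> L |U|\<close>, and these bounds add up over the disjoint detached sets.\<close>

lemma small_separator:
  assumes "finite V" and L: "L \<ge> 2" and cyc: "\<And>vs. is_cycle E vs \<Longrightarrow> length vs < L"
  shows "\<exists>Y\<subseteq>V. s * card Y \<le> L * card V \<and> all_connected_parts_small E s (V - Y)"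
  using assms(1)
proof (induction "card V" arbitrary: V rule: less_induct)
  case less
  show ?case
  proof (cases "all_connected_parts_small E s V")
    case True
    then show ?thesis by (intro exI[of _ "{}"]) auto
  next
    case False
    then obtain C\<^sub>0 where C0: "C\<^sub>0 \<subseteq> V" "connected_in E C\<^sub>0" "card C\<^sub>0 > s"
      by (auto simp: all_connected_parts_small_def not_le)
    obtain C where C: "C\<^sub>0 \<subseteq> C" "C \<subseteq> V" "connected_in E C"
      "\<And>c b. c \<in> C \<Longrightarrow> b \<in> V - C \<Longrightarrow> {c, b} \<notin> E"
      using exists_component_containing[of V C\<^sub>0 E] C0 less.prems by blast
    have "card C > s"
      using less_le_trans[OF C0(3) card_mono[OF finite_subset[OF C(2) less.prems] C(1)]] .
    moreover have "neighbourhood E V C = {}"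
      using C(4) by (auto simp: neighbourhood_def)
    ultimately have "\<exists>U X. U \<subseteq> V \<and> X \<subseteq> V \<and> card U > s \<and> card X \<le> L \<and>
        neighbourhood E V U \<subseteq> X \<and> all_connected_parts_small E s (U - X)"
      by (intro detach_large_set_along_path[where P = "[]" and U = C, OF less.prems L cyc] C(2,3)) simp_all
    then obtain U X where UX: "U \<subseteq> V" "X \<subseteq> V" "card U > s" "card X \<le> L"
      "neighbourhood E V U \<subseteq> X" "all_connected_parts_small E s (U - X)"
      by blast
    have cardU: "card (V - U) = card V - card U" "card U \<le> card V"
      using UX(1) less.prems by (auto simp: card_Diff_subset finite_subset card_mono)
    then have "card (V - U) < card V" using UX(3) by simp
    then obtain Y where Y: "Y \<subseteq> V - U" "s * card Y \<le> L * card (V - U)"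
      "all_connected_parts_small E s (V - U - Y)"
      using less.hyps[of "V - U"] less.prems by blast
    have "s * card (X \<union> Y) \<le> s * (card X + card Y)"
      by (intro mult_le_mono2 card_Un_le)
    also have "\<dots> = s * card X + s * card Y" by (rule add_mult_distrib2)
    also have "s * card X \<le> card U * L" using UX(3,4) by (intro mult_le_mono) auto
    also note Y(2)
    also have "card U * L + L * card (V - U) = L * card V" using cardU by (simp add: mult.commute[of _ L] flip: add_mult_distrib2)
    finally have "s * card (X \<union> Y) \<le> L * card V" by simp
    moreover have "all_connected_parts_small E s (V - (X \<union> Y))"
      unfolding all_connected_parts_small_def
    proof (intro allI impI)
      fix D assume D: "D \<subseteq> V - (X \<union> Y)" "connected_in E D"
      \<comment> \<open>All edges leaving \<open>U\<close> end in \<open>X\<close>, so a connected set that avoids \<open>X\<close> cannot straddle \<open>U\<close>.\<close>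
      consider "D \<inter> U = {}" | "D \<subseteq> U" | "D \<inter> U \<noteq> {}" "D \<inter> U \<noteq> D" by blast
      then show "card D \<le> s"
      proof cases
        case 1
        then have "D \<subseteq> V - U - Y" using D by blast
        then show ?thesis using Y(3) D(2) by (auto simp: all_connected_parts_small_def)
      next
        case 2
        then have "D \<subseteq> U - X" using D by blast
        then show ?thesis using UX(6) D(2) by (auto simp: all_connected_parts_small_def)
      next
        case 3
        then obtain a b where "a \<in> D \<inter> U" "b \<in> D - D \<inter> U" "{a, b} \<in> E"
          using connected_in_crossing_edge[OF D(2), of "D \<inter> U"] by blast
        then have "b \<in> neighbourhood E V U" using D(1)
          by (auto simp: neighbourhood_def)
        then show ?thesis using UX(5) D(1) \<open>b \<in> D - D \<inter> U\<close> by blast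
      qed
    qed
    ultimately show ?thesis using UX(2) Y(1) by (intro exI[of _ "X \<union> Y"]) auto
  qed
qed

text \<open>The components have at most \<open>s\<close> vertices, are vertex-disjoint and contain all the edges, so their
  edge bounds add up.\<close>

lemma sparse_if_all_connected_parts_small:
  fixes c :: real
  assumes "finite Z" "all_connected_parts_small E s Z" and E: "\<And>e. e \<in> E \<Longrightarrow> card e = 2"
    and sparse: "\<And>S. S \<subseteq> Z \<Longrightarrow> card S \<le> s \<Longrightarrow> real (card {e \<in> E. e \<subseteq> S}) \<le> c * real (card S)"
  shows "real (card {e \<in> E. e \<subseteq> Z}) \<le> c * real (card Z)"
  using assms(1,2,4)
proof (induction "card Z" arbitrary: Z rule: less_induct)
  case less
  show ?case
  proof (cases "Z = {}")
    case True
    then show ?thesis using less.prems(3)[of "{}"] by auto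
  next
    case False
    then obtain z where "z \<in> Z" by blast
    obtain C where C: "{z} \<subseteq> C" "C \<subseteq> Z" "connected_in E C"
      "\<And>c b. c \<in> C \<Longrightarrow> b \<in> Z - C \<Longrightarrow> {c, b} \<notin> E"
      using exists_component_containing[of Z "{z}" E] connected_in_singleton[of E z] \<open>z \<in> Z\<close>
        less.prems(1) by blast
    have fin: "finite C" "finite (Z - C)" using C(2) less.prems(1) finite_subset by auto
    have split: "{e \<in> E. e \<subseteq> Z} \<subseteq> {e \<in> E. e \<subseteq> C} \<union> {e \<in> E. e \<subseteq> Z - C}"
    proof
      fix e assume e: "e \<in> {e \<in> E. e \<subseteq> Z}"
      then obtain x y where "e = {x, y}" using E by (metis card_2_iff mem_Collect_eq)
      then show "e \<in> {e \<in> E. e \<subseteq> C} \<union> {e \<in> E. e \<subseteq> Z - C}"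
        using e C(4)[of x y] C(4)[of y x] by (auto simp: insert_commute)
    qed
    have "card C > 0" using fin(1) C(1) by (auto simp: card_gt_0_iff)
    then have card: "card Z = card C + card (Z - C)" and less_card: "card (Z - C) < card Z"
      using C(2) fin less.prems(1) card_mono[OF less.prems(1) C(2)] by (auto simp: card_Diff_subset)
    have "card C \<le> s" using less.prems(2) C(2,3) by (auto simp: all_connected_parts_small_def)
    then have "real (card {e \<in> E. e \<subseteq> C}) \<le> c * real (card C)" using less.prems(3) C(2) by blast
    moreover have "real (card {e \<in> E. e \<subseteq> Z - C}) \<le> c * real (card (Z - C))"
      using less.prems by (intro less.hyps[OF less_card])
        (auto simp: all_connected_parts_small_def)
    moreover have "finite ({e \<in> E. e \<subseteq> C} \<union> {e \<in> E. e \<subseteq> Z - C})"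
      using fin by (auto intro: finite_subset[of _ "Pow C"] finite_subset[of _ "Pow (Z - C)"])
    then have "card {e \<in> E. e \<subseteq> Z} \<le> card {e \<in> E. e \<subseteq> C} + card {e \<in> E. e \<subseteq> Z - C}"
      by (rule le_trans[OF card_mono[OF _ split] card_Un_le])
    ultimately show ?thesis unfolding card by (simp add: algebra_simps)
  qed
qed

text \<open>If all cycles were shorter than \<open>L\<close>, a small separator \<open>Y\<close> would split the edges of \<open>H\<close> into those
  avoiding \<open>Y\<close>, at most \<open>c |V|\<close> by local sparsity, and those meeting \<open>Y\<close>, at most \<open>b\<close>.\<close>

lemma long_cycle_if_locally_sparse:
  fixes b c :: real
  assumes "finite V" "H \<subseteq> all_edges V" "L \<ge> 2" "c \<ge> 0"
    and sparse: "\<And>S. S \<subseteq> V \<Longrightarrow> card S \<le> s \<Longrightarrow> real (card (H \<inter> all_edges S)) \<le> c * real (card S)"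
    and few: "\<And>Y. Y \<subseteq> V \<Longrightarrow> s * card Y \<le> L * card V \<Longrightarrow> real (card {e \<in> H. e \<inter> Y \<noteq> {}}) \<le> b"
    and many: "real (card H) > c * real (card V) + b"
  shows "\<exists>vs. is_cycle H vs \<and> length vs \<ge> L"
proof (rule ccontr)
  assume "\<not> (\<exists>vs. is_cycle H vs \<and> length vs \<ge> L)"
  then have cyc: "length vs < L" if "is_cycle H vs" for vs using that not_le by blast
  obtain Y where Y: "Y \<subseteq> V" "s * card Y \<le> L * card V" "all_connected_parts_small H s (V - Y)"
    using small_separator[OF assms(1,3) cyc] by blast
  have edge: "card e = 2" "e \<subseteq> V" if "e \<in> H" for e
    using that assms(2) by (auto simp: all_edges_def)
  have "finite (Pow V)" using assms(1) by simp
  then have finH: "finite H" by (rule finite_subset[rotated]) (use edge in auto)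
  have within: "{e \<in> H. e \<subseteq> S} = H \<inter> all_edges S" for S
    using edge by (auto simp: all_edges_def)
  have "real (card {e \<in> H. e \<subseteq> V - Y}) \<le> c * real (card (V - Y))"
  proof (rule sparse_if_all_connected_parts_small[OF _ Y(3)])
    show "real (card {e \<in> H. e \<subseteq> S}) \<le> c * real (card S)" if "S \<subseteq> V - Y" "card S \<le> s" for S
      unfolding within using that by (intro sparse) auto
  qed (use assms(1) edge in auto)
  also have "\<dots> \<le> c * real (card V)"
    using assms(1,4) by (intro mult_left_mono) (auto intro: card_mono)
  finally have inner: "real (card {e \<in> H. e \<subseteq> V - Y}) \<le> c * real (card V)" .
  have "{e \<in> H. e \<subseteq> V - Y} \<union> {e \<in> H. e \<inter> Y \<noteq> {}} = H"
    using edge(2) by auto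
  then have "card H \<le> card {e \<in> H. e \<subseteq> V - Y} + card {e \<in> H. e \<inter> Y \<noteq> {}}"
    using card_Un_le[of "{e \<in> H. e \<subseteq> V - Y}" "{e \<in> H. e \<inter> Y \<noteq> {}}"] by simp
  then show False using inner few[OF Y(1,2)] many by linarith
qed

section \<open>Binomial random graphs\<close>

lemma finite_all_edges [simp]: "finite V \<Longrightarrow> finite (all_edges V)"
  by (auto simp: all_edges_def intro: finite_subset[of _ "Pow V"])

lemma card_all_edges_le:
  assumes "finite V"
  shows "card (all_edges V) \<le> card V ^ 2"
proof -
  have "card (all_edges V) = card V choose 2"
    using n_subsets[OF assms, of 2] by (simp add: all_edges_def)
  then show ?thesis
    using binomial_le_pow[of 2 "card V"] by (cases "2 \<le> card V") (auto simp: binomial_eq_0)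
qed

text \<open>The term of index \<open>k\<close> in the exponential series of \<open>k\<close> is at most the whole sum.\<close>

lemma power_le_exp_times_fact: "real k ^ k \<le> exp (real k) * fact k"
proof -
  have "(\<Sum>i\<in>{k}. inverse (fact i) * real k ^ i) \<le> (\<Sum>i. inverse (fact i) * real k ^ i)"
    by (intro sum_le_suminf summable_exp) auto
  also have "\<dots> = exp (real k)" by (simp add: exp_def)
  finally show ?thesis by (simp add: field_simps)
qed

lemma binomial_le_exp_power:
  assumes "k \<ge> 1"
  shows "real (N choose k) \<le> (exp 1 * real N / real k) ^ k"
proof -
  have "real (N choose k) * fact k \<le> real N ^ k"
    using binomial_fact_pow[of N k] by (metis of_nat_fact of_nat_le_iff of_nat_mult of_nat_power)
  moreover have "real (N choose k) * real k ^ k \<le> real (N choose k) * (exp (real k) * fact k)"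
    by (intro mult_left_mono power_le_exp_times_fact) simp
  ultimately have "real (N choose k) * real k ^ k \<le> exp (real k) * real N ^ k"
    by (smt (verit) exp_gt_zero mult.assoc mult.commute mult_left_mono)
  also have "exp (real k) = exp 1 ^ k" by (simp flip: exp_of_nat_mult)
  finally show ?thesis using assms by (simp add: field_simps power_mult_distrib power_divide)
qed

lemma prob_gnp_superset:
  assumes "0 \<le> p" "p \<le> 1" "F \<subseteq> all_edges {..<n}"
  shows "measure_pmf.prob (gnp n p) {E. F \<subseteq> E} = p ^ card F"
proof -
  let ?A = "all_edges {..<n}"
  have "measure_pmf.prob (gnp n p) {E. F \<subseteq> E} =
      measure_pmf.prob (Pi_pmf ?A False (\<lambda>_. bernoulli_pmf p)) (Pi ?A (\<lambda>e. if e \<in> F then {True} else UNIV))"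
    unfolding gnp_def measure_map_pmf using assms(3)
    by (intro arg_cong[where f = "measure_pmf.prob _"]) (auto simp: Pi_def split: if_splits)
  also have "\<dots> = (\<Prod>e\<in>?A. if e \<in> F then p else 1)"
    using assms(1,2) by (subst measure_Pi_pmf_Pi)
      (auto intro!: prod.cong simp: measure_pmf_single)
  also have "\<dots> = p ^ card F"
    using assms(3) by (simp add: prod.If_cases Int_absorb1 finite_subset)
  finally show ?thesis .
qed

text \<open>The first moment bound behind both random graph estimates: a union bound over the \<open>m\<close>-element
  subsets of \<open>F\<close>, each of which is present with probability \<open>p ^ m\<close>.\<close>

lemma prob_gnp_many_edges:
  assumes "0 \<le> p" "p \<le> 1" "F \<subseteq> all_edges {..<n}"
    and "real (card F) \<le> N" "1 \<le> m"
  shows "measure_pmf.prob (gnp n p) {E. m \<le> card (E \<inter> F)} \<le> (exp 1 * N * p / real m) ^ m"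
proof -
  have fin: "finite F" using assms(3) by (rule finite_subset) simp
  let ?T = "{T. T \<subseteq> F \<and> card T = m}"
  have finT: "finite ?T" using fin by simp
  have "{E. m \<le> card (E \<inter> F)} \<subseteq> (\<Union>T\<in>?T. {E. T \<subseteq> E})"
  proof
    fix E assume "E \<in> {E. m \<le> card (E \<inter> F)}"
    then obtain T where "T \<subseteq> E \<inter> F" "card T = m"
      by (metis mem_Collect_eq obtain_subset_with_card_n)
    then show "E \<in> (\<Union>T\<in>?T. {E. T \<subseteq> E})" by auto
  qed
  then have "measure_pmf.prob (gnp n p) {E. m \<le> card (E \<inter> F)} \<le>
      measure_pmf.prob (gnp n p) (\<Union>T\<in>?T. {E. T \<subseteq> E})"
    by (intro measure_pmf.finite_measure_mono) auto
  also have "\<dots> \<le> (\<Sum>T\<in>?T. measure_pmf.prob (gnp n p) {E. T \<subseteq> E})"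
    by (intro measure_pmf.finite_measure_subadditive_finite finT) auto
  also have "\<dots> = (\<Sum>T\<in>?T. p ^ m)"
    using assms by (intro sum.cong refl) (auto simp: prob_gnp_superset)
  also have "\<dots> = real (card F choose m) * p ^ m"
    using n_subsets[OF fin, of m] by simp
  also have "\<dots> \<le> (exp 1 * real (card F) / real m) ^ m * p ^ m"
    using assms by (intro mult_right_mono binomial_le_exp_power) auto
  also have "\<dots> = (exp 1 * real (card F) * p / real m) ^ m"
    by (simp add: power_mult_distrib power_divide)
  also have "\<dots> \<le> (exp 1 * N * p / real m) ^ m"
    using assms by (intro power_mono divide_right_mono mult_right_mono mult_left_mono) auto
  finally show ?thesis .
qed

lemma set_pmf_gnp_subset: "E \<in> set_pmf (gnp n p) \<Longrightarrow> E \<subseteq> all_edges {..<n}"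
  by (auto simp: gnp_def)

text \<open>Keeping every edge of \<open>G(n, p)\<close> independently with probability \<open>q / p\<close> gives \<open>G(n, q)\<close>.
  So both graphs live on one probability space, in which the second is a subgraph of the first.\<close>

lemma prob_gnp_mono:
  assumes "0 \<le> q" "q \<le> p" "p \<le> 1" and mono: "\<And>E E'. E \<subseteq> E' \<Longrightarrow> Q E \<Longrightarrow> Q E'"
  shows "measure_pmf.prob (gnp n q) {E. Q E} \<le> measure_pmf.prob (gnp n p) {E. Q E}"
proof (cases "p = 0")
  case True
  then show ?thesis using assms by simp
next
  case False
  define A where "A = all_edges {..<n}"
  define joint where "joint = pair_pmf (bernoulli_pmf p) (bernoulli_pmf (q / p))"
  define \<Omega> where "\<Omega> = Pi_pmf A (False, False) (\<lambda>_. joint)"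
  have [simp]: "finite A" by (simp add: A_def)
  have qp: "0 \<le> q / p" "q / p \<le> 1" using assms False by auto
  have "pmf (map_pmf (\<lambda>(x, y). x \<and> y) joint) True = q"
  proof -
    have "(\<lambda>(x, y). x \<and> y) -` {True} = {(True, True)}" by auto
    then show ?thesis
      using assms qp False by (simp add: joint_def pmf_map measure_pmf_single pmf_pair)
  qed
  then have "map_pmf (\<lambda>(x, y). x \<and> y) joint = bernoulli_pmf q"
    using assms by (intro pmf_eqI) (metis (full_types) pmf_False_conv_True pmf_bernoulli_True order_trans)
  then have q: "Pi_pmf A False (\<lambda>_. bernoulli_pmf q) = map_pmf (\<lambda>h. (\<lambda>(x, y). x \<and> y) \<circ> h) \<Omega>"
    unfolding \<Omega>_def by (subst Pi_pmf_map[symmetric]) auto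
  have p: "Pi_pmf A False (\<lambda>_. bernoulli_pmf p) = map_pmf (\<lambda>h. fst \<circ> h) \<Omega>"
    unfolding \<Omega>_def by (subst Pi_pmf_map[symmetric]) (auto simp: joint_def map_fst_pair_pmf)
  have "Q {e \<in> A. fst (h e)}" if "Q {e \<in> A. (\<lambda>(x, y). x \<and> y) (h e)}" for h
    using that by (rule mono[rotated]) (auto simp: case_prod_unfold)
  then show ?thesis
    unfolding gnp_def A_def[symmetric] q p map_pmf_comp measure_map_pmf
    by (intro measure_pmf.finite_measure_mono) auto
qed

lemma whp_conj:
  assumes "whp p P" "whp p Q"
  shows "whp p (\<lambda>n E. P n E \<and> Q n E)"
proof -
  let ?pr = "\<lambda>n R. measure_pmf.prob (gnp n (p n)) {E. R n E}"
  have "?pr n P + ?pr n Q - 1 \<le> ?pr n (\<lambda>n E. P n E \<and> Q n E)" for n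
  proof -
    have "?pr n P + ?pr n Q = measure_pmf.prob (gnp n (p n)) ({E. P n E} \<union> {E. Q n E}) +
        ?pr n (\<lambda>n E. P n E \<and> Q n E)"
      unfolding Collect_conj_eq
      by (subst measure_Un3) (simp_all add: measure_pmf.fmeasurable_eq_sets)
    then show ?thesis
      using measure_pmf.prob_le_1[of "gnp n (p n)" "{E. P n E} \<union> {E. Q n E}"] by linarith
  qed
  then have lower: "\<forall>\<^sub>F n in sequentially. ?pr n P + ?pr n Q - 1 \<le> ?pr n (\<lambda>n E. P n E \<and> Q n E)"
    by simp
  have upper: "\<forall>\<^sub>F n in sequentially. ?pr n (\<lambda>n E. P n E \<and> Q n E) \<le> 1"
    by (rule always_eventually) (rule allI, rule measure_pmf.prob_le_1)
  have "(\<lambda>n. ?pr n P + ?pr n Q - 1) \<longlonglongrightarrow> 1"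
    using tendsto_diff[OF tendsto_add[OF assms[unfolded whp_def]] tendsto_const[of 1]] by simp
  then show ?thesis
    unfolding whp_def by (rule tendsto_sandwich[OF lower upper _ tendsto_const])
qed

text \<open>Besides moving from \<open>q\<close> up to \<open>p\<close>, this allows the implication between the two properties to use
  that an outcome of \<open>G(n, q)\<close> consists of edges on \<open>{..<n}\<close>.\<close>

lemma whp_transfer_mono:
  assumes "whp q P" "edge_probability p" "edge_probability q"
    and "\<forall>\<^sub>F n in sequentially. q n \<le> p n"
    and imp: "\<forall>\<^sub>F n in sequentially. \<forall>E. E \<subseteq> all_edges {..<n} \<longrightarrow> P n E \<longrightarrow> Q n E"
    and mono: "\<And>n E E'. E \<subseteq> E' \<Longrightarrow> Q n E \<Longrightarrow> Q n E'"
  shows "whp p Q"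
  unfolding whp_def
proof (rule tendsto_sandwich[OF _ _ assms(1)[unfolded whp_def] tendsto_const])
  show "\<forall>\<^sub>F n in sequentially. measure_pmf.prob (gnp n (q n)) {E. P n E} \<le>
      measure_pmf.prob (gnp n (p n)) {E. Q n E}"
    using assms(4) imp
  proof eventually_elim
    case (elim n)
    have "measure_pmf.prob (gnp n (q n)) {E. P n E} \<le> measure_pmf.prob (gnp n (q n)) {E. Q n E}"
      using elim(2) set_pmf_gnp_subset by (intro measure_pmf.finite_measure_mono_AE) (auto simp: AE_measure_pmf_iff)
    also have "\<dots> \<le> measure_pmf.prob (gnp n (p n)) {E. Q n E}"
      using assms(2,3) elim(1) mono by (intro prob_gnp_mono) (auto simp: edge_probability_def)
    finally show ?case .
  qed
qed auto

lemma whp_if_prob_compl_tendsto_0: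
  assumes "(\<lambda>n. measure_pmf.prob (gnp n (p n)) {E. \<not> P n E}) \<longlonglongrightarrow> 0"
  shows "whp p P"
proof -
  have "measure_pmf.prob (gnp n (p n)) {E. P n E} =
      1 - measure_pmf.prob (gnp n (p n)) {E. \<not> P n E}" for n
    using measure_pmf.prob_compl[of "{E. \<not> P n E}" "gnp n (p n)"]
    by (simp add: Collect_neg_eq Compl_eq_Diff_UNIV[symmetric])
  then show ?thesis
    unfolding whp_def using tendsto_diff[OF tendsto_const[of 1] assms] by simp
qed

section \<open>Sparsity of random graphs\<close>

lemma Suc_nat_floor_le:
  fixes y :: real
  assumes "0 \<le> y" "y < real j"
  shows "nat \<lfloor>y\<rfloor> + 1 \<le> j"
  using assms by (simp add: Suc_le_eq nat_less_iff floor_less_iff)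

text \<open>Here and in \<open>few_incident_edges\<close>, intersecting with \<open>all_edges\<close> makes the counted set of edges the
  trace of \<open>E\<close> on a fixed set of pairs, so that \<open>prob_gnp_many_edges\<close> applies to it for arbitrary \<open>E\<close>.\<close>

definition locally_sparse :: "real \<Rightarrow> real \<Rightarrow> nat \<Rightarrow> nat set set \<Rightarrow> bool" where
  "locally_sparse \<eta> \<alpha> n E \<longleftrightarrow> (\<forall>S\<subseteq>{..<n}. real (card S) \<le> \<alpha> * real n \<longrightarrow>
     real (card (E \<inter> all_edges S)) \<le> (1 + \<eta>) * real (card S))"

text \<open>With \<open>x = e C k / n\<close>, a fixed set of \<open>k\<close> vertices is too dense with probability at most
  \<open>x powr ((1 + \<eta>) k)\<close>, and there are at most \<open>(e n / k) ^ k\<close> such sets. In the product the factor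
  \<open>n / k\<close> cancels one factor \<open>x\<close>, and the excess \<open>\<eta>\<close> in the exponent leaves \<open>x powr \<eta>\<close>, which is small
  when \<open>k / n\<close> is.\<close>

lemma prob_gnp_dense_set:
  fixes \<eta> C \<alpha> :: real
  assumes \<eta>: "\<eta> > 0" and C: "C > 0" and \<alpha>: "exp 1 * C * \<alpha> \<le> 1"
    and p: "0 \<le> p" "p \<le> 1" "p \<le> C / real n"
    and k: "1 \<le> k" "real k \<le> \<alpha> * real n"
  shows "measure_pmf.prob (gnp n p)
      {E. \<exists>S\<subseteq>{..<n}. card S = k \<and> \<not> real (card (E \<inter> all_edges S)) \<le> (1 + \<eta>) * real k}
    \<le> (exp 1 ^ 2 * C * (exp 1 * C * (real k / real n)) powr \<eta>) ^ k"
proof -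
  let ?pr = "measure_pmf.prob (gnp n p)"
  define x where "x = exp 1 * C * (real k / real n)"
  define m where "m = nat \<lfloor>(1 + \<eta>) * real k\<rfloor> + 1"
  have n: "n > 0" using k by (cases n) auto
  have "real k / real n \<le> \<alpha>" using k(2) n by (simp add: field_simps)
  then have "x \<le> exp 1 * C * \<alpha>" unfolding x_def using C by (intro mult_left_mono) auto
  with \<alpha> have "x \<le> 1" by linarith
  moreover have "0 < x" using C k(1) n by (simp add: x_def)
  ultimately have x: "0 < x" "x \<le> 1" by auto
  have m: "(1 + \<eta>) * real k < real m" "1 \<le> m" unfolding m_def using \<eta> by auto linarith
  have "real k \<le> (1 + \<eta>) * real k" using \<eta> by (simp add: algebra_simps)
  with m have km: "real k \<le> real m" by simp
  have dense: "m \<le> j" if "\<not> real j \<le> (1 + \<eta>) * real k" for j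
    unfolding m_def using that \<eta> by (intro Suc_nat_floor_le) auto
  let ?S = "{S. S \<subseteq> {..<n} \<and> card S = k}"
  have "{E. \<exists>S\<subseteq>{..<n}. card S = k \<and> \<not> real (card (E \<inter> all_edges S)) \<le> (1 + \<eta>) * real k}
      \<subseteq> (\<Union>S\<in>?S. {E. m \<le> card (E \<inter> all_edges S)})"
    using dense by blast
  then have "?pr {E. \<exists>S\<subseteq>{..<n}. card S = k \<and> \<not> real (card (E \<inter> all_edges S)) \<le> (1 + \<eta>) * real k}
      \<le> ?pr (\<Union>S\<in>?S. {E. m \<le> card (E \<inter> all_edges S)})"
    by (intro measure_pmf.finite_measure_mono) auto
  also have "\<dots> \<le> (\<Sum>S\<in>?S. ?pr {E. m \<le> card (E \<inter> all_edges S)})"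
    by (intro measure_pmf.finite_measure_subadditive_finite) auto
  also have "\<dots> \<le> (\<Sum>S\<in>?S. x powr ((1 + \<eta>) * real k))"
  proof (intro sum_mono)
    fix S assume S: "S \<in> ?S"
    then have "finite S" using finite_subset by blast
    then have "card (all_edges S) \<le> k ^ 2"
      using card_all_edges_le[of S] S by simp
    then have card: "real (card (all_edges S)) \<le> real k ^ 2"
      by (simp flip: of_nat_power)
    have "?pr {E. m \<le> card (E \<inter> all_edges S)} \<le> (exp 1 * real k ^ 2 * p / real m) ^ m"
      using p S m(2) card by (intro prob_gnp_many_edges) (auto simp: all_edges_def)
    also have "\<dots> \<le> x ^ m"
    proof (intro power_mono)
      \<comment> \<open>Replacing \<open>m\<close> by the smaller \<open>k\<close> loses only a constant factor in the base.\<close>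
      have "exp 1 * real k ^ 2 * p / real m \<le> exp 1 * real k ^ 2 * (C / real n) / real k"
        using p k km C by (intro frac_le mult_left_mono) auto
      also have "\<dots> = x" using k by (simp add: x_def power2_eq_square)
      finally show "exp 1 * real k ^ 2 * p / real m \<le> x" .
    qed (use p in auto)
    also have "\<dots> = x powr real m" using x by (simp add: powr_realpow)
    also have "\<dots> \<le> x powr ((1 + \<eta>) * real k)" using x m by (intro powr_mono') auto
    finally show "?pr {E. m \<le> card (E \<inter> all_edges S)} \<le> x powr ((1 + \<eta>) * real k)" .
  qed
  also have "\<dots> = real (n choose k) * (x * x powr \<eta>) ^ k"
  proof -
    have "x powr ((1 + \<eta>) * real k) = (x powr (1 + \<eta>)) powr real k" by (simp add: powr_powr)
    also have "\<dots> = (x * x powr \<eta>) ^ k" using x by (simp add: powr_realpow powr_add)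
    finally show ?thesis using n_subsets[of "{..<n}" k] by simp
  qed
  also have "\<dots> \<le> (exp 1 * real n / real k) ^ k * (x * x powr \<eta>) ^ k"
    using x k by (intro mult_right_mono binomial_le_exp_power) auto
  also have "\<dots> = (exp 1 ^ 2 * C * x powr \<eta>) ^ k"
    unfolding power_mult_distrib[symmetric] using k n by (simp add: x_def power2_eq_square mult_ac)
  finally show ?thesis by (simp add: x_def)
qed

text \<open>The union bound over the sizes \<open>k\<close> is a series whose terms are at most \<open>(1/2) ^ k\<close> by the choice of
  \<open>\<alpha>\<close> and tend to \<open>0\<close> for every fixed \<open>k\<close>. Tannery's theorem (dominated convergence for series)
  therefore makes the sum tend to \<open>0\<close>.\<close>

lemma whp_locally_sparse:
  fixes \<eta> C :: real
  assumes \<eta>: "\<eta> > 0" and C: "C > 0"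
  shows "\<exists>\<alpha>>0. \<forall>p. edge_probability p \<longrightarrow> (\<forall>\<^sub>F n in sequentially. p n \<le> C / real n) \<longrightarrow>
    whp p (locally_sparse \<eta> \<alpha>)"
proof -
  \<comment> \<open>\<open>\<beta>\<close> is the value of \<open>e C k / n\<close> at \<open>k = \<alpha> n\<close>: it is chosen to make the base of the bound at most \<open>1/2\<close>.\<close>
  define \<beta> where "\<beta> = min 1 ((1 / (2 * (exp 1 ^ 2 * C))) powr (1 / \<eta>))"
  define \<alpha> where "\<alpha> = \<beta> / (exp 1 * C)"
  have \<beta>: "0 < \<beta>" "\<beta> \<le> 1" using C by (auto simp: \<beta>_def)
  have "\<alpha> > 0" using \<beta> C by (simp add: \<alpha>_def)
  have ex: "exp 1 * C * \<alpha> = \<beta>" using C by (simp add: \<alpha>_def)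
  have half: "exp 1 ^ 2 * C * \<beta> powr \<eta> \<le> 1 / 2"
  proof -
    have "\<beta> powr \<eta> \<le> ((1 / (2 * (exp 1 ^ 2 * C))) powr (1 / \<eta>)) powr \<eta>"
      using \<beta> \<eta> by (intro powr_mono2) (auto simp: \<beta>_def)
    also have "\<dots> = 1 / (2 * (exp 1 ^ 2 * C))" using \<eta> C by (simp add: powr_powr)
    finally show ?thesis using C by (simp add: field_simps)
  qed
  define a where "a k n = (if 1 \<le> k \<and> real k \<le> \<alpha> * real n
    then (exp 1 ^ 2 * C * (exp 1 * C * (real k / real n)) powr \<eta>) ^ k else 0)" for k n :: nat
  have a_nonneg: "0 \<le> a k n" for k n using C by (simp add: a_def)
  have a_le: "a k n \<le> (1 / 2) ^ k" for k n
  proof (cases "1 \<le> k \<and> real k \<le> \<alpha> * real n")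
    case True
    then have "n > 0" by (cases n) auto
    then have "real k / real n \<le> \<alpha>" using True by (simp add: field_simps)
    then have "exp 1 * C * (real k / real n) \<le> \<beta>"
      unfolding ex[symmetric] using C by (intro mult_left_mono) auto
    then have "exp 1 ^ 2 * C * (exp 1 * C * (real k / real n)) powr \<eta> \<le> exp 1 ^ 2 * C * \<beta> powr \<eta>"
      using C \<eta> by (intro mult_left_mono powr_mono2) auto
    then have "exp 1 ^ 2 * C * (exp 1 * C * (real k / real n)) powr \<eta> \<le> 1 / 2"
      using half by linarith
    then have "(exp 1 ^ 2 * C * (exp 1 * C * (real k / real n)) powr \<eta>) ^ k \<le> (1 / 2) ^ k"
      using C by (intro power_mono) auto
    then show ?thesis using True unfolding a_def by simp
  next
    case False
    then show ?thesis unfolding a_def if_not_P[OF False] by simp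
  qed
  have a_lim: "(\<lambda>n. a k n) \<longlonglongrightarrow> 0" for k
  proof (cases "k = 0")
    case False
    have "(\<lambda>n. real k / real n) \<longlonglongrightarrow> 0" by (rule lim_const_over_n)
    then have "(\<lambda>n. exp 1 * C * (real k / real n)) \<longlonglongrightarrow> 0" by (rule tendsto_mult_right_zero)
    then have "(\<lambda>n. (exp 1 * C * (real k / real n)) powr \<eta>) \<longlonglongrightarrow> 0 powr \<eta>"
      using \<eta> C by (intro tendsto_powr' tendsto_const) auto
    then have "(\<lambda>n. (exp 1 ^ 2 * C * (exp 1 * C * (real k / real n)) powr \<eta>) ^ k)
        \<longlonglongrightarrow> (exp 1 ^ 2 * C * 0 powr \<eta>) ^ k"
      by (intro tendsto_power tendsto_mult_left)
    moreover have "(exp 1 ^ 2 * C * 0 powr \<eta>) ^ k = 0" using \<eta> False by simp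
    ultimately have lim: "(\<lambda>n. (exp 1 ^ 2 * C * (exp 1 * C * (real k / real n)) powr \<eta>) ^ k) \<longlonglongrightarrow> 0"
      by metis
    have "a k n \<le> (exp 1 ^ 2 * C * (exp 1 * C * (real k / real n)) powr \<eta>) ^ k" for n
      using C by (simp add: a_def)
    then show ?thesis
      using a_nonneg by (intro tendsto_sandwich[OF _ _ tendsto_const lim] always_eventually allI)
  qed (simp add: a_def)
  have sum_lim: "(\<lambda>n. \<Sum>k. a k n) \<longlonglongrightarrow> 0"
  proof -
    have "\<forall>\<^sub>F (k, n) in at_top \<times>\<^sub>F sequentially. norm (a k n) \<le> (1 / 2) ^ k"
      using a_le a_nonneg by (intro always_eventually) simp
    from tannerys_theorem[OF a_lim this] show ?thesis by simp
  qed
  have "whp p (locally_sparse \<eta> \<alpha>)"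
    if p: "edge_probability p" "\<forall>\<^sub>F n in sequentially. p n \<le> C / real n" for p
  proof (rule whp_if_prob_compl_tendsto_0, rule tendsto_sandwich[OF _ _ tendsto_const sum_lim])
    show "\<forall>\<^sub>F n in sequentially.
        measure_pmf.prob (gnp n (p n)) {E. \<not> locally_sparse \<eta> \<alpha> n E} \<le> (\<Sum>k. a k n)"
      using p(2)
    proof eventually_elim
      case (elim n)
      let ?pr = "measure_pmf.prob (gnp n (p n))"
      define K where "K = {k. 1 \<le> k \<and> real k \<le> \<alpha> * real n}"
      have "K \<subseteq> {..nat \<lfloor>\<alpha> * real n\<rfloor>}" by (auto simp: K_def le_nat_floor)
      then have fin: "finite K" by (rule finite_subset) simp
      define Bad where "Bad k = {E. \<exists>S\<subseteq>{..<n}. card S = k \<and>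
        \<not> real (card (E \<inter> all_edges S)) \<le> (1 + \<eta>) * real k}" for k
      have "{E. \<not> locally_sparse \<eta> \<alpha> n E} \<subseteq> (\<Union>k\<in>K. Bad k)"
      proof
        fix E assume "E \<in> {E. \<not> locally_sparse \<eta> \<alpha> n E}"
        then obtain S where S: "S \<subseteq> {..<n}" "real (card S) \<le> \<alpha> * real n"
          "\<not> real (card (E \<inter> all_edges S)) \<le> (1 + \<eta>) * real (card S)"
          by (auto simp: locally_sparse_def)
        have "card S \<noteq> 0"
        proof
          assume "card S = 0"
          then have "S = {}" using S(1) finite_subset[of S "{..<n}"] by auto
          then have "all_edges S = {}" by (auto simp: all_edges_def)
          then show False using S(3) \<open>card S = 0\<close> by simp
        qed
        then have "card S \<in> K" using S by (auto simp: K_def)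
        then show "E \<in> (\<Union>k\<in>K. Bad k)" using S by (auto simp: Bad_def)
      qed
      then have "?pr {E. \<not> locally_sparse \<eta> \<alpha> n E} \<le> ?pr (\<Union>k\<in>K. Bad k)"
        by (intro measure_pmf.finite_measure_mono) auto
      also have "\<dots> \<le> (\<Sum>k\<in>K. ?pr (Bad k))"
        by (intro measure_pmf.finite_measure_subadditive_finite fin) auto
      also have "\<dots> \<le> (\<Sum>k\<in>K. a k n)"
      proof (intro sum_mono)
        fix k assume k: "k \<in> K"
        show "?pr (Bad k) \<le> a k n"
          using prob_gnp_dense_set[OF \<eta> C, of \<alpha> "p n" n k] p(1) elim \<beta> ex k
          by (auto simp: Bad_def a_def K_def edge_probability_def)
      qed
      also have "\<dots> = (\<Sum>k. a k n)"
        by (rule suminf_finite[symmetric, OF fin]) (auto simp: K_def a_def)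
      finally show ?case .
    qed
  qed auto
  then show ?thesis using \<open>\<alpha> > 0\<close> by blast
qed

definition few_incident_edges :: "real \<Rightarrow> real \<Rightarrow> nat \<Rightarrow> nat set set \<Rightarrow> bool" where
  "few_incident_edges \<beta> \<gamma> n E \<longleftrightarrow> (\<forall>Y\<subseteq>{..<n}. real (card Y) \<le> \<gamma> * real n \<longrightarrow>
     real (card {e \<in> E \<inter> all_edges {..<n}. e \<inter> Y \<noteq> {}}) \<le> \<beta> * real n)"

lemma card_incident_edges_le:
  "card {e \<in> all_edges {..<n}. e \<inter> Y \<noteq> {}} \<le> card Y * n" if "Y \<subseteq> {..<n}" for Y :: "nat set"
proof -
  have fin: "finite (Y \<times> {..<n})" using that finite_subset by auto
  have "{e \<in> all_edges {..<n}. e \<inter> Y \<noteq> {}} \<subseteq> (\<lambda>(y, x). {y, x}) ` (Y \<times> {..<n})"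
  proof
    fix e assume e: "e \<in> {e \<in> all_edges {..<n}. e \<inter> Y \<noteq> {}}"
    then obtain x y where "e = {x, y}" by (auto simp: all_edges_def card_2_iff)
    moreover have "x < n" "y < n" using e \<open>e = {x, y}\<close> by (auto simp: all_edges_def)
    ultimately show "e \<in> (\<lambda>(y, x). {y, x}) ` (Y \<times> {..<n})"
      using e by (auto simp: image_iff insert_commute)
  qed
  then have "card {e \<in> all_edges {..<n}. e \<inter> Y \<noteq> {}} \<le> card ((\<lambda>(y, x). {y, x}) ` (Y \<times> {..<n}))"
    using fin by (intro card_mono finite_imageI)
  also have "\<dots> \<le> card (Y \<times> {..<n})" using fin by (rule card_image_le)
  finally show ?thesis by (simp add: card_cartesian_product)
qed

text \<open>At most \<open>\<gamma> n\<^sup>2\<close> pairs meet a given set \<open>Y\<close> of at most \<open>\<gamma> n\<close> vertices, so \<open>Y\<close> meets more than \<open>\<beta> n\<close> edges with probability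
  at most \<open>(e C \<gamma> / \<beta>) powr (\<beta> n)\<close>. For small \<open>\<gamma>\<close> this is at most \<open>(1/4) ^ n\<close>, which beats the
  \<open>2 ^ n\<close> choices of \<open>Y\<close>.\<close>

lemma whp_few_incident_edges:
  fixes \<beta> C :: real
  assumes \<beta>: "\<beta> > 0" and C: "C > 0"
  shows "\<exists>\<gamma>>0. \<forall>p. edge_probability p \<longrightarrow> (\<forall>\<^sub>F n in sequentially. p n \<le> C / real n) \<longrightarrow>
    whp p (few_incident_edges \<beta> \<gamma>)"
proof -
  \<comment> \<open>\<open>x\<close> is the base \<open>e C \<gamma> / \<beta>\<close>, and \<open>\<gamma>\<close> is solved from \<open>x powr \<beta> = 1/4\<close>.\<close>
  define x where "x = (1 / 4) powr (1 / \<beta>)"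
  define \<gamma> where "\<gamma> = x * \<beta> / (exp 1 * C)"
  have x: "0 < x" "x \<le> 1" "x powr \<beta> = 1 / 4"
    using \<beta> powr_le_one_le[of "1 / 4"] by (auto simp: x_def powr_powr powr_le1)
  have "\<gamma> > 0" using x \<beta> C by (simp add: \<gamma>_def)
  have lim: "(\<lambda>n. (1 / 2) ^ n) \<longlonglongrightarrow> (0::real)" by (rule LIMSEQ_power_zero) simp
  have "whp p (few_incident_edges \<beta> \<gamma>)"
    if p: "edge_probability p" "\<forall>\<^sub>F n in sequentially. p n \<le> C / real n" for p
  proof (rule whp_if_prob_compl_tendsto_0, rule tendsto_sandwich[OF _ _ tendsto_const lim])
    show "\<forall>\<^sub>F n in sequentially.
        measure_pmf.prob (gnp n (p n)) {E. \<not> few_incident_edges \<beta> \<gamma> n E} \<le> (1 / 2) ^ n"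
      using p(2) eventually_gt_at_top[of 0]
    proof eventually_elim
      case (elim n)
      let ?pr = "measure_pmf.prob (gnp n (p n))"
      define m where "m = nat \<lfloor>\<beta> * real n\<rfloor> + 1"
      have m: "\<beta> * real n < real m" "1 \<le> m" unfolding m_def using \<beta> by auto linarith
      define F where "F Y = {e \<in> all_edges {..<n}. e \<inter> Y \<noteq> {}}" for Y
      define \<Y> where "\<Y> = {Y. Y \<subseteq> {..<n} \<and> real (card Y) \<le> \<gamma> * real n}"
      have sub: "\<Y> \<subseteq> Pow {..<n}" by (auto simp: \<Y>_def)
      then have fin: "finite \<Y>" by (rule finite_subset) simp
      have "{E. \<not> few_incident_edges \<beta> \<gamma> n E} \<subseteq> (\<Union>Y\<in>\<Y>. {E. m \<le> card (E \<inter> F Y)})"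
      proof
        fix E assume "E \<in> {E. \<not> few_incident_edges \<beta> \<gamma> n E}"
        then obtain Y where Y: "Y \<in> \<Y>"
          "\<not> real (card {e \<in> E \<inter> all_edges {..<n}. e \<inter> Y \<noteq> {}}) \<le> \<beta> * real n"
          by (auto simp: few_incident_edges_def \<Y>_def)
        have "{e \<in> E \<inter> all_edges {..<n}. e \<inter> Y \<noteq> {}} = E \<inter> F Y" by (auto simp: F_def)
        with Y(2) have "m \<le> card (E \<inter> F Y)"
          unfolding m_def using \<beta> by (intro Suc_nat_floor_le) auto
        then show "E \<in> (\<Union>Y\<in>\<Y>. {E. m \<le> card (E \<inter> F Y)})" using Y(1) by blast
      qed
      then have "?pr {E. \<not> few_incident_edges \<beta> \<gamma> n E} \<le> ?pr (\<Union>Y\<in>\<Y>. {E. m \<le> card (E \<inter> F Y)})"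
        by (intro measure_pmf.finite_measure_mono) auto
      also have "\<dots> \<le> (\<Sum>Y\<in>\<Y>. ?pr {E. m \<le> card (E \<inter> F Y)})"
        by (intro measure_pmf.finite_measure_subadditive_finite fin) auto
      also have "\<dots> \<le> (\<Sum>Y\<in>\<Y>. (1 / 4) ^ n)"
      proof (intro sum_mono)
        fix Y assume Y: "Y \<in> \<Y>"
        have "real (card (F Y)) \<le> real (card Y) * real n"
          using card_incident_edges_le[of Y n] Y unfolding F_def \<Y>_def
          by (metis (no_types, lifting) mem_Collect_eq of_nat_le_iff of_nat_mult)
        also have "\<dots> \<le> \<gamma> * real n * real n" using Y by (intro mult_right_mono) (auto simp: \<Y>_def)
        finally have "?pr {E. m \<le> card (E \<inter> F Y)} \<le> (exp 1 * (\<gamma> * real n * real n) * p n / real m) ^ m"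
          using p(1) m by (intro prob_gnp_many_edges) (auto simp: edge_probability_def F_def)
        also have "\<dots> \<le> x ^ m"
        proof (intro power_mono)
          have "exp 1 * (\<gamma> * real n * real n) * p n / real m
              \<le> exp 1 * (\<gamma> * real n * real n) * (C / real n) / (\<beta> * real n)"
            using elim m \<open>\<gamma> > 0\<close> \<beta> C by (intro frac_le mult_left_mono) auto
          also have "\<dots> = x" using elim \<beta> C by (simp add: \<gamma>_def)
          finally show "exp 1 * (\<gamma> * real n * real n) * p n / real m \<le> x" .
        qed (use p(1) \<open>\<gamma> > 0\<close> in \<open>auto simp: edge_probability_def\<close>)
        also have "\<dots> = x powr real m" using x by (simp add: powr_realpow)
        also have "\<dots> \<le> x powr (\<beta> * real n)" using x m by (intro powr_mono') auto
        also have "\<dots> = (x powr \<beta>) powr real n" by (simp add: powr_powr)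
        also have "\<dots> = (1 / 4) ^ n" unfolding x(3) by (simp add: powr_realpow)
        finally show "?pr {E. m \<le> card (E \<inter> F Y)} \<le> (1 / 4) ^ n" .
      qed
      also have "\<dots> \<le> 2 ^ n * (1 / 4) ^ n"
      proof -
        have "card \<Y> \<le> 2 ^ n" using card_mono[OF _ sub] by (simp add: card_Pow)
        then have "real (card \<Y>) \<le> 2 ^ n" by (metis of_nat_le_iff of_nat_numeral of_nat_power)
        then show ?thesis by (simp add: mult_right_mono)
      qed
      also have "\<dots> = (1 / 2) ^ n" by (simp flip: power_mult_distrib)
      finally show ?case .
    qed
  qed auto
  then show ?thesis using \<open>\<gamma> > 0\<close> by blast
qed

section \<open>Long monochromatic cycles\<close>

lemma average_degree_eq_card_edges:
  assumes "finite V" "E \<subseteq> all_edges V"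
  shows "average_degree V E = 2 * real (card E) / real (card V)"
proof -
  have fin: "finite E" using assms by (auto intro: finite_subset)
  have "card {v \<in> V. v \<in> e} = 2" if "e \<in> E" for e
  proof -
    have "{v \<in> V. v \<in> e} = e" using that assms(2) by (auto simp: all_edges_def)
    then show ?thesis using that assms(2) by (auto simp: all_edges_def)
  qed
  then have "(\<Sum>v\<in>V. card {e \<in> E. v \<in> e}) = 2 * card E"
    using assms(1) fin by (intro sum_multicount) auto
  then show ?thesis
    by (simp add: average_degree_def degree_def flip: of_nat_sum)
qed

lemma majority_colour:
  assumes "finite E" "edge_coloring r E c" "r > 0"
  shows "\<exists>i<r. real (card E) \<le> real r * real (card {e \<in> E. c e = i})"
proof (rule ccontr)
  assume "\<not> ?thesis"
  then have less: "real r * real (card {e \<in> E. c e = i}) < real (card E)" if "i < r" for i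
    using that by (meson not_le)
  have "c ` E \<subseteq> {..<r}" using assms(2) by (auto simp: edge_coloring_def)
  then have "card E = (\<Sum>i<r. card {e \<in> E. c e = i})"
    using assms(1) sum.group[of E "{..<r}" c "\<lambda>_. 1::nat"] by simp
  then have "real r * real (card E) = (\<Sum>i<r. real r * real (card {e \<in> E. c e = i}))"
    by (simp add: sum_distrib_left)
  also have "\<dots> < (\<Sum>i<r. real (card E))"
    using less assms(3) by (intro sum_strict_mono) auto
  also have "\<dots> = real r * real (card E)" by simp
  finally show False by simp
qed

text \<open>The deterministic core. The cycle length \<open>\<alpha> \<gamma> n / 4\<close> is chosen so that a separator \<open>Y\<close> with
  \<open>s |Y| \<le> L |V'|\<close> has at most \<open>\<gamma> n\<close> vertices when \<open>s\<close> and \<open>L\<close> are \<open>\<alpha> n\<close> and \<open>\<alpha> \<gamma> n / 4\<close> rounded to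
  integers. The two lower bounds on \<open>n\<close> ensure that rounding changes \<open>s\<close> and \<open>L\<close> by a factor of at
  most two.\<close>

lemma monochromatic_long_cycle:
  fixes r n :: nat and \<delta>' \<eta> \<alpha> \<gamma> :: real
  assumes r: "r \<ge> 1" and \<delta>': "\<delta>' > 0" and \<eta>: "\<eta> = \<delta>' / (4 * real r)" and \<alpha>: "\<alpha> > 0"
    and large: "\<alpha> * real n \<ge> 2" "\<alpha> * \<gamma> / 4 * real n > 1"
    and sub: "is_subgraph V' E' {..<n} E" and "V' \<noteq> {}"
    and dense: "average_degree V' E' \<ge> 2 * real r + \<delta>'"
    and sparse: "locally_sparse \<eta> \<alpha> n E"
    and few: "few_incident_edges (\<eta> * \<alpha> / 2) \<gamma> n E"
    and E: "E \<subseteq> all_edges {..<n}" and c: "edge_coloring r E c"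
  shows "\<exists>i<r. \<exists>vs. is_cycle {e \<in> E. c e = i} vs \<and> real (length vs) \<ge> \<alpha> * \<gamma> / 4 * real n"
proof -
  have V': "V' \<subseteq> {..<n}" "finite V'" and E': "E' \<subseteq> E" "E' \<subseteq> all_edges V'" "finite E'"
    and finE: "finite E"
    using sub E finite_subset[of E "all_edges {..<n}"]
    by (auto simp: is_subgraph_def dest: finite_subset)
  have card_pos: "card V' > 0" using V'(2) \<open>V' \<noteq> {}\<close> by (simp add: card_gt_0_iff)
  have "\<eta> > 0" using \<eta> \<delta>' r by simp
  have r\<eta>: "real r * (1 + 2 * \<eta>) = real r + \<delta>' / 2" using \<eta> r by (simp add: field_simps)
  have manyE': "real r * (1 + 2 * \<eta>) * real (card V') \<le> real (card E')"
    using dense card_pos unfolding average_degree_eq_card_edges[OF V'(2) E'(2)] r\<eta> by (simp add: field_simps)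
  have V'_large: "real (card V') > \<alpha> * real n"
  proof (rule ccontr)
    assume "\<not> ?thesis"
    then have "real (card (E \<inter> all_edges V')) \<le> (1 + \<eta>) * real (card V')"
      using sparse V'(1) by (auto simp: locally_sparse_def)
    moreover have "card E' \<le> card (E \<inter> all_edges V')"
      using E' finE by (intro card_mono) auto
    moreover have "(1 + \<eta>) * real (card V') < real r * (1 + 2 * \<eta>) * real (card V')"
    proof (rule mult_strict_right_mono)
      have "1 + \<eta> < 1 * (1 + 2 * \<eta>)" using \<open>\<eta> > 0\<close> by simp
      also have "\<dots> \<le> real r * (1 + 2 * \<eta>)" using r \<open>\<eta> > 0\<close> by (intro mult_right_mono) auto
      finally show "1 + \<eta> < real r * (1 + 2 * \<eta>)" .
    qed (use card_pos in simp)
    ultimately show False using manyE' by linarith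
  qed
  have "edge_coloring r E' c" using c E'(1) by (auto simp: edge_coloring_def)
  then obtain i where i: "i < r" "real (card E') \<le> real r * real (card {e \<in> E'. c e = i})"
    using majority_colour[OF E'(3)] r by force
  define H where "H = {e \<in> E'. c e = i}"
  have H: "H \<subseteq> E'" "H \<subseteq> all_edges V'" using E' by (auto simp: H_def)
  have "real r * ((1 + 2 * \<eta>) * real (card V')) \<le> real r * real (card H)"
    using manyE' i(2) by (simp add: H_def mult.assoc)
  then have manyH: "(1 + 2 * \<eta>) * real (card V') \<le> real (card H)" using r by simp
  define s where "s = nat \<lfloor>\<alpha> * real n\<rfloor>"
  define L where "L = nat \<lceil>\<alpha> * \<gamma> / 4 * real n\<rceil>"
  have s: "real s \<le> \<alpha> * real n" "\<alpha> * real n / 2 \<le> real s"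
    unfolding s_def using large(1) by linarith+
  have L: "\<alpha> * \<gamma> / 4 * real n \<le> real L" "real L \<le> 2 * (\<alpha> * \<gamma> / 4 * real n)" "L \<ge> 2"
    unfolding L_def using large(2) by linarith+
  have "\<exists>vs. is_cycle H vs \<and> length vs \<ge> L"
  proof (rule long_cycle_if_locally_sparse)
    show "finite V'" "H \<subseteq> all_edges V'" "L \<ge> 2" "0 \<le> 1 + \<eta>"
      using V' H L \<open>\<eta> > 0\<close> by auto
    show "real (card (H \<inter> all_edges S)) \<le> (1 + \<eta>) * real (card S)"
      if S: "S \<subseteq> V'" "card S \<le> s" for S
    proof -
      have "real (card S) \<le> \<alpha> * real n" using S(2) s(1) by linarith
      then have "real (card (E \<inter> all_edges S)) \<le> (1 + \<eta>) * real (card S)"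
        using sparse S(1) V'(1) by (auto simp: locally_sparse_def)
      moreover have "card (H \<inter> all_edges S) \<le> card (E \<inter> all_edges S)"
        using H E' finE by (intro card_mono) auto
      ultimately show ?thesis by linarith
    qed
    show "real (card {e \<in> H. e \<inter> Y \<noteq> {}}) \<le> \<eta> * \<alpha> / 2 * real n"
      if Y: "Y \<subseteq> V'" "s * card Y \<le> L * card V'" for Y
    proof -
      have "card V' \<le> n" using card_mono[OF _ V'(1)] by simp
      have "\<alpha> * real n / 2 * real (card Y) \<le> real s * real (card Y)"
        using s(2) by (rule mult_right_mono) simp
      also have "\<dots> \<le> real L * real (card V')" using Y(2) by (metis of_nat_le_iff of_nat_mult)
      also have "\<dots> \<le> 2 * (\<alpha> * \<gamma> / 4 * real n) * real n"
        using L(2) large(2) \<open>card V' \<le> n\<close> by (intro mult_mono) auto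
      also have "\<dots> = \<alpha> * real n / 2 * (\<gamma> * real n)" by simp
      finally have "real (card Y) \<le> \<gamma> * real n"
        using large(1) by (subst (asm) mult_le_cancel_left_pos) auto
      then have "real (card {e \<in> E \<inter> all_edges {..<n}. e \<inter> Y \<noteq> {}}) \<le> \<eta> * \<alpha> / 2 * real n"
        using few Y(1) V'(1) by (auto simp: few_incident_edges_def)
      moreover have "card {e \<in> H. e \<inter> Y \<noteq> {}} \<le> card {e \<in> E \<inter> all_edges {..<n}. e \<inter> Y \<noteq> {}}"
        using H E' E finE by (intro card_mono) auto
      ultimately show ?thesis by linarith
    qed
    have "\<eta> * (\<alpha> * real n) < \<eta> * real (card V')"
      using V'_large \<open>\<eta> > 0\<close> by simp
    moreover have "0 \<le> \<eta> * (\<alpha> * real n)" using \<open>\<eta> > 0\<close> \<alpha> by simp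
    ultimately show "(1 + \<eta>) * real (card V') + \<eta> * \<alpha> / 2 * real n < real (card H)"
      using manyH by (simp add: algebra_simps)
  qed
  then obtain vs where vs: "is_cycle H vs" "length vs \<ge> L" by blast
  have "is_cycle {e \<in> E. c e = i} vs"
    using vs(1) by (rule is_cycle_mono) (use E' in \<open>auto simp: H_def\<close>)
  moreover have "real (length vs) \<ge> \<alpha> * \<gamma> / 4 * real n" using vs(2) L(1) by linarith
  ultimately show ?thesis using i(1) by blast
qed

theorem theorem5:
  fixes r :: nat and \<psi> \<epsilon> :: real
  assumes "r \<ge> 2"
    and "orientability_threshold r \<psi>"
    and "\<epsilon> > 0"
  shows "\<exists>\<delta>>0. \<forall>p. edge_probability p \<longrightarrow>
           (\<forall>\<^sub>F n in sequentially. p n \<ge> (\<psi> + \<epsilon>) / real n) \<longrightarrow>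
           whp p (\<lambda>n E. \<forall>c. edge_coloring r E c \<longrightarrow>
              (\<exists>i<r. \<exists>vs. is_cycle {e \<in> E. c e = i} vs \<and>
                          real (length vs) \<ge> \<delta> * real n))"
proof -
  \<comment> \<open>The threshold is applied with \<open>\<epsilon> / 2\<close> because it needs a strict lower bound on the edge probability.\<close>
  have "\<epsilon> / 2 > 0" using assms(3) by simp
  then obtain \<delta>' where \<delta>': "\<delta>' > 0" and dense: "\<And>p. edge_probability p \<Longrightarrow>
      \<forall>\<^sub>F n in sequentially. p n > (\<psi> + \<epsilon> / 2) / real n \<Longrightarrow>
      whp p (\<lambda>n E. \<exists>V' E'. is_subgraph V' E' {..<n} E \<and> V' \<noteq> {} \<and>
                          average_degree V' E' \<ge> 2 * real r + \<delta>')"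
    using assms(2) unfolding orientability_threshold_def by blast
  define C where "C = \<bar>\<psi> + \<epsilon>\<bar> + 1"
  define \<eta> where "\<eta> = \<delta>' / (4 * real r)"
  have "C > 0" "\<eta> > 0" using \<delta>' assms(1) by (auto simp: C_def \<eta>_def)
  then obtain \<alpha> where \<alpha>: "\<alpha> > 0" and sparse: "\<And>p. edge_probability p \<Longrightarrow>
      \<forall>\<^sub>F n in sequentially. p n \<le> C / real n \<Longrightarrow> whp p (locally_sparse \<eta> \<alpha>)"
    using whp_locally_sparse by blast
  have "\<eta> * \<alpha> / 2 > 0" using \<open>\<eta> > 0\<close> \<alpha> by simp
  then obtain \<gamma> where \<gamma>: "\<gamma> > 0" and few: "\<And>p. edge_probability p \<Longrightarrow>
      \<forall>\<^sub>F n in sequentially. p n \<le> C / real n \<Longrightarrow> whp p (few_incident_edges (\<eta> * \<alpha> / 2) \<gamma>)"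
    using whp_few_incident_edges[OF _ \<open>C > 0\<close>] by blast
  define \<delta> where "\<delta> = \<alpha> * \<gamma> / 4"
  have "\<delta> > 0" using \<alpha> \<gamma> by (simp add: \<delta>_def)
  define Good where "Good n E \<longleftrightarrow> (\<forall>c. edge_coloring r E c \<longrightarrow>
      (\<exists>i<r. \<exists>vs. is_cycle {e \<in> E. c e = i} vs \<and> real (length vs) \<ge> \<delta> * real n))"
    for n and E :: "nat set set"
  have mono: "Good n E'" if sub: "E \<subseteq> E'" and good: "Good n E" for n E E'
    unfolding Good_def
  proof (intro allI impI)
    fix c assume "edge_coloring r E' c"
    then have "edge_coloring r E c" using sub by (auto simp: edge_coloring_def)
    then obtain i vs where "i < r" "is_cycle {e \<in> E. c e = i} vs" "real (length vs) \<ge> \<delta> * real n"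
      using good by (auto simp: Good_def)
    moreover have "{e \<in> E. c e = i} \<subseteq> {e \<in> E'. c e = i}" using sub by auto
    ultimately show "\<exists>i<r. \<exists>vs. is_cycle {e \<in> E'. c e = i} vs \<and> real (length vs) \<ge> \<delta> * real n"
      using is_cycle_mono by blast
  qed
  \<comment> \<open>Truncated to \<open>[0, 1]\<close>; for large \<open>n\<close> only the truncation at \<open>0\<close> could take effect.\<close>
  define q where "q n = max 0 (min 1 ((\<psi> + \<epsilon>) / real n))" for n :: nat
  have q: "edge_probability q" by (auto simp: edge_probability_def q_def)
  have large: "\<forall>\<^sub>F n in sequentially. K < real n" for K
    by (rule eventually_compose_filterlim[OF eventually_gt_at_top filterlim_real_sequentially])
  have q_le: "\<forall>\<^sub>F n in sequentially. q n \<le> C / real n"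
    using large[of 0]
  proof eventually_elim
    case (elim n)
    have "(\<psi> + \<epsilon>) / real n \<le> C / real n" "0 \<le> C / real n"
      using elim by (auto simp: C_def intro!: divide_right_mono)
    then show ?case by (auto simp: q_def)
  qed
  have "\<forall>\<^sub>F n in sequentially. q n > (\<psi> + \<epsilon> / 2) / real n"
    using large[of C]
  proof eventually_elim
    case (elim n)
    then have "n > 0" "(\<psi> + \<epsilon>) / real n \<le> 1" by (auto simp: C_def field_simps)
    moreover have "(\<psi> + \<epsilon> / 2) / real n < (\<psi> + \<epsilon>) / real n"
      using assms(3) \<open>n > 0\<close> by (intro divide_strict_right_mono) auto
    ultimately show ?case by (auto simp: q_def)
  qed
  from whp_conj[OF dense[OF q this] whp_conj[OF sparse[OF q q_le] few[OF q q_le]]]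
  have typical: "whp q (\<lambda>n E. (\<exists>V' E'. is_subgraph V' E' {..<n} E \<and> V' \<noteq> {} \<and>
        average_degree V' E' \<ge> 2 * real r + \<delta>') \<and>
      locally_sparse \<eta> \<alpha> n E \<and> few_incident_edges (\<eta> * \<alpha> / 2) \<gamma> n E)" .
  have "whp p Good"
    if p: "edge_probability p" "\<forall>\<^sub>F n in sequentially. p n \<ge> (\<psi> + \<epsilon>) / real n" for p
  proof (rule whp_transfer_mono[OF typical p(1) q _ _ mono])
    show "\<forall>\<^sub>F n in sequentially. q n \<le> p n"
      using p(2) by eventually_elim (use p(1) in \<open>auto simp: q_def edge_probability_def\<close>)
    show "\<forall>\<^sub>F n in sequentially. \<forall>E. E \<subseteq> all_edges {..<n} \<longrightarrow>
        (\<exists>V' E'. is_subgraph V' E' {..<n} E \<and> V' \<noteq> {} \<and>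
          average_degree V' E' \<ge> 2 * real r + \<delta>') \<and>
        locally_sparse \<eta> \<alpha> n E \<and> few_incident_edges (\<eta> * \<alpha> / 2) \<gamma> n E \<longrightarrow> Good n E"
      using large[of "2 / \<alpha>"] large[of "1 / \<delta>"]
    proof eventually_elim
      case (elim n)
      have n: "\<alpha> * real n \<ge> 2" "\<alpha> * \<gamma> / 4 * real n > 1"
        using elim \<alpha> \<open>\<delta> > 0\<close> by (auto simp: field_simps simp flip: \<delta>_def)
      have "r \<ge> 1" using assms(1) by simp
      then show ?case
        unfolding Good_def \<delta>_def
        by (blast intro: monochromatic_long_cycle[OF _ \<delta>' \<eta>_def \<alpha> n])
    qed
  qed
  then show ?thesis using \<open>\<delta> > 0\<close> unfolding Good_def by blast
qed

end
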